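(* Let $A$ be a unital complex Banach algebra and let $a\in A$ be such that its Moore-Penrose inverse $a^{\dag}$ exists. Then, for each one of the statements (i)--(iv) below, $a$ is EP if and only if the group inverse $a^{\sharp}$ exists and that statement holds: (i) $a=a^{\dag}a^2$; (ii) $a=a^2a^{\dag}$; (iii) $a^{\dag}=a(a^{\dag})^2$; (iv) $a^{\dag}=(a^{\dag})^2a$.
   Context: Let $A$ be a unital complex Banach algebra. An element $h\in A$ is hermitian if $\|\exp(ith)\|=1$ for all $t\in\mathbb{R}$. Given $a\in A$, an element $x\in A$ is the Moore-Penrose inverse of $a$, denoted $a^{\dag}$, if $a=axa$, $x=xax$, and both $ax$ and $xa$ are hermitian; there is at most one such $x$. An element $b\in A$ is the group inverse of $a$, denoted $a^{\sharp}$, if $a=aba$, $b=bab$ and $ab=ba$; it is unique if it exists. An element $a\in A$ is EP if $a^{\dag}$ exists and $aa^{\dag}=a^{\dag}a$. *)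

theory Defs
  imports "HOL-Analysis.Analysis"
begin

text \<open>
  The library has real but no complex Banach algebras. The class below adds a complex scalar
  multiplication to a real unital Banach algebra, compatible with the real one, with the product
  and with the norm.

  The superclass \<open>real_normed_algebra_1\<close> contains \<open>norm 1 = 1\<close> (and so \<open>0 \<noteq> 1\<close>). This costs no
  generality for Moore-Penrose inverses: at \<open>t = 0\<close> the hermitian condition
  \<open>\<parallel>exp (\<i>th)\<parallel> = 1\<close> already reads \<open>\<parallel>1\<parallel> = 1\<close>.
\<close>

class complex_banach_algebra_1 = real_normed_algebra_1 + banach +
  fixes scaleC :: "complex \<Rightarrow> 'a \<Rightarrow> 'a"  (infixr "*\<^sub>C" 75)
  assumes scaleC_add_right: "c *\<^sub>C (x + y) = c *\<^sub>C x + c *\<^sub>C y"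
    and scaleC_add_left: "(c + d) *\<^sub>C x = c *\<^sub>C x + d *\<^sub>C x"
    and scaleC_scaleC: "c *\<^sub>C (d *\<^sub>C x) = (c * d) *\<^sub>C x"
    and scaleC_one: "1 *\<^sub>C x = x"
    and scaleC_of_real: "complex_of_real r *\<^sub>C x = r *\<^sub>R x"
    and mult_scaleC_left: "(c *\<^sub>C x) * y = c *\<^sub>C (x * y)"
    and mult_scaleC_right: "x * (c *\<^sub>C y) = c *\<^sub>C (x * y)"
    and norm_scaleC: "norm (c *\<^sub>C x) = cmod c * norm x"

instantiation complex :: complex_banach_algebra_1
begin

definition scaleC_complex :: "complex \<Rightarrow> complex \<Rightarrow> complex"
  where "scaleC_complex c x = c * x"

instance
  by standard (simp_all add: scaleC_complex_def algebra_simps norm_mult scaleR_conv_of_real)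

end

definition hermitian :: "'a::complex_banach_algebra_1 \<Rightarrow> bool"
  where "hermitian h \<longleftrightarrow> (\<forall>t::real. norm (exp ((\<i> * complex_of_real t) *\<^sub>C h)) = 1)"

definition is_mp_inverse :: "'a::complex_banach_algebra_1 \<Rightarrow> 'a \<Rightarrow> bool"
  where "is_mp_inverse a x \<longleftrightarrow>
    a = a * x * a \<and> x = x * a * x \<and> hermitian (a * x) \<and> hermitian (x * a)"

definition is_group_inverse :: "'a::complex_banach_algebra_1 \<Rightarrow> 'a \<Rightarrow> bool"
  where "is_group_inverse a b \<longleftrightarrow> a = a * b * a \<and> b = b * a * b \<and> a * b = b * a"

definition is_EP :: "'a::complex_banach_algebra_1 \<Rightarrow> bool"
  where "is_EP a \<longleftrightarrow> (\<exists>x. is_mp_inverse a x \<and> a * x = x * a)"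

end

theory Submission
  imports Defs
begin

text \<open>
  Write \<open>x\<close> for the Moore-Penrose inverse of \<open>a\<close>. Then \<open>a * x\<close> is a hermitian idempotent with the
  same range as \<open>a\<close>, and \<open>x * a\<close> is a hermitian idempotent with the same kernel as \<open>a\<close>
  (think of left multiplications). The whole proof rests on a rigidity property: a hermitian
  idempotent is determined by its range, and also by its kernel. In a C*-algebra this follows by
  taking adjoints; here it comes from the norm. If \<open>p\<close> is a hermitian idempotent, the exponential
  at \<open>t = \<pi>\<close> is the reflection \<open>1 - 2p\<close>, which therefore has norm one. When \<open>p\<close> and \<open>q\<close> share their
  range or their kernel, a product of the two reflections is \<open>1 - 2d\<close> with \<open>d = q - p\<close> and \<open>d\<^sup>2 = 0\<close>.
  Its powers \<open>1 - 2nd\<close> all have norm at most one, which forces \<open>d = 0\<close>.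

  Rigidity gives the uniqueness of the Moore-Penrose inverse, so that an EP element commutes with
  \<open>x\<close>; then \<open>x\<close> is itself a group inverse and the four identities are immediate. Conversely, a
  group inverse \<open>b\<close> yields the idempotent \<open>e = a * b = b * a\<close>, with the range and the kernel of \<open>a\<close>.
  Each of the four identities compares the range or the kernel of \<open>x\<close> with that of \<open>a\<close> and
  makes \<open>e\<close> equal to \<open>x * a\<close> or to \<open>a * x\<close>. So \<open>e\<close> is hermitian, and rigidity, applied to the range
  or to the kernel, identifies it with the other product too.
\<close>

section \<open>Reflections of hermitian idempotents\<close>

lemma bounded_linear_scaleC_left:
  "bounded_linear (\<lambda>c. c *\<^sub>C (p::'a::complex_banach_algebra_1))"
proof (rule bounded_linear_intro[where K = "norm p"])
  fix r :: real and c :: complex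
  have "(r *\<^sub>R c) *\<^sub>C p = (complex_of_real r * c) *\<^sub>C p"
    by (simp add: scaleR_conv_of_real)
  also have "\<dots> = complex_of_real r *\<^sub>C (c *\<^sub>C p)"
    by (simp add: scaleC_scaleC)
  finally show "(r *\<^sub>R c) *\<^sub>C p = r *\<^sub>R (c *\<^sub>C p)"
    by (simp add: scaleC_of_real)
qed (simp_all add: scaleC_add_left norm_scaleC)

lemma scaleC_idempotent_power:
  fixes p :: "'a::complex_banach_algebra_1"
  assumes "p * p = p"
  shows "(c *\<^sub>C p) ^ Suc n = c ^ Suc n *\<^sub>C p"
proof (induction n)
  case 0
  show ?case by simp
next
  case (Suc n)
  have "(c *\<^sub>C p) ^ Suc (Suc n) = (c *\<^sub>C p) * (c ^ Suc n *\<^sub>C p)"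
    using Suc by (simp only: power_Suc[of _ "Suc n"])
  also have "\<dots> = c ^ Suc (Suc n) *\<^sub>C p"
    using assms by (simp add: mult_scaleC_left mult_scaleC_right scaleC_scaleC mult.commute)
  finally show ?case .
qed

text \<open>
  Every power of \<open>c *\<^sub>C p\<close> except the zeroth is a multiple of \<open>p\<close>, so the exponential series of
  \<open>c *\<^sub>C p\<close> is the scalar one multiplied by \<open>p\<close>, up to the constant term.
\<close>

lemma exp_scaleC_idempotent:
  fixes p :: "'a::complex_banach_algebra_1"
  assumes "p * p = p"
  shows "exp (c *\<^sub>C p) = 1 + (exp c - 1) *\<^sub>C p"
proof -
  have "(\<lambda>n. c ^ n /\<^sub>R fact n) sums exp c"
    by (rule exp_converges)
  then have "(\<lambda>n. c ^ Suc n /\<^sub>R fact (Suc n)) sums (exp c - 1)"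
    by (subst sums_Suc_iff) simp
  then have "(\<lambda>n. (c ^ Suc n /\<^sub>R fact (Suc n)) *\<^sub>C p) sums ((exp c - 1) *\<^sub>C p)"
    by (rule bounded_linear.sums[OF bounded_linear_scaleC_left])
  moreover have "(c ^ Suc n /\<^sub>R fact (Suc n)) *\<^sub>C p = (c *\<^sub>C p) ^ Suc n /\<^sub>R fact (Suc n)" for n
    unfolding scaleC_idempotent_power[OF assms]
    by (rule linear_scale[OF bounded_linear.linear[OF bounded_linear_scaleC_left]])
  ultimately have "(\<lambda>n. (c *\<^sub>C p) ^ Suc n /\<^sub>R fact (Suc n)) sums ((exp c - 1) *\<^sub>C p)"
    by simp
  then have "(\<lambda>n. (c *\<^sub>C p) ^ n /\<^sub>R fact n) sums ((exp c - 1) *\<^sub>C p + 1)"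
    by (subst (asm) sums_Suc_iff) simp
  then show ?thesis
    using exp_converges[of "c *\<^sub>C p"] sums_unique2 by (metis add.commute)
qed

lemma norm_reflection_hermitian_idempotent:
  fixes p :: "'a::complex_banach_algebra_1"
  assumes "p * p = p" and "hermitian p"
  shows "norm (1 - 2 * p) = 1"
proof -
  have "exp ((\<i> * complex_of_real pi) *\<^sub>C p) = 1 + (complex_of_real (-2)) *\<^sub>C p"
    using exp_scaleC_idempotent[OF assms(1)] by simp
  also have "\<dots> = 1 - 2 * p"
    unfolding scaleC_of_real by (simp add: scaleR_2 mult_2)
  finally show ?thesis
    using assms(2) unfolding hermitian_def by metis
qed

section \<open>Rigidity of hermitian idempotents\<close>

text \<open>
  Because \<open>d\<close> squares to zero, the powers of the contraction \<open>1 - 2 * d\<close> grow linearly unless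
  \<open>d = 0\<close>.
\<close>

lemma square_zero_eq_0_if_contraction:
  fixes d :: "'a::real_normed_algebra_1"
  assumes "d * d = 0" and "norm (1 - 2 * d) \<le> 1"
  shows "d = 0"
proof (rule ccontr)
  assume "d \<noteq> 0"
  have pow: "(1 - 2 * d) ^ n = 1 - (2 * real n) *\<^sub>R d" for n
  proof (induction n)
    case (Suc n)
    have "(1 - 2 * d) ^ Suc n = (1 - 2 *\<^sub>R d) * (1 - (2 * real n) *\<^sub>R d)"
      unfolding power_Suc Suc by (simp only: scaleR_2 mult_2)
    also have "\<dots> = 1 - (2 * real n) *\<^sub>R d - 2 *\<^sub>R d"
      using assms(1) by (simp add: left_diff_distrib right_diff_distrib)
    also have "\<dots> = 1 - (2 * real (Suc n)) *\<^sub>R d"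
      by (simp add: scaleR_left_distrib distrib_left)
    finally show ?case .
  qed simp
  have bound: "2 * real n * norm d \<le> 2" for n
  proof -
    have "norm ((1 - 2 * d) ^ n) \<le> 1"
      by (meson assms(2) norm_ge_zero norm_power_ineq order_trans power_le_one)
    then have "norm (1 - (2 * real n) *\<^sub>R d) \<le> 1"
      by (simp add: pow)
    moreover have "norm ((2 * real n) *\<^sub>R d) \<le> norm (1::'a) + norm (1 - (2 * real n) *\<^sub>R d)"
      using norm_triangle_ineq4[of 1 "1 - (2 * real n) *\<^sub>R d"] by simp
    ultimately show ?thesis by simp
  qed
  obtain n where "1 < real n * norm d"
    using \<open>d \<noteq> 0\<close> reals_Archimedean3[of "norm d"] by auto
  then show False
    using bound[of n] by simp
qed

text \<open>
  The equations \<open>p * q = q\<close> and \<open>q * p = p\<close> say that \<open>p\<close> and \<open>q\<close> have the same range. They turn the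
  product of the reflections of \<open>q\<close> and \<open>p\<close> into \<open>1 - 2 * (q - p)\<close>.
\<close>

lemma hermitian_idempotent_eq_if_same_range:
  fixes p q :: "'a::complex_banach_algebra_1"
  assumes "hermitian p" "hermitian q" and "p * p = p" "q * q = q"
    and "p * q = q" "q * p = p"
  shows "p = q"
proof -
  have "(q - p) * (q - p) = 0"
    using assms(3-6) by (simp add: algebra_simps)
  moreover have "norm (1 - 2 * (q - p)) \<le> 1"
  proof -
    have "(1 - 2 * q) * (1 - 2 * p) = 1 - 2 * (q - p)"
      using assms(3-6) by (simp add: algebra_simps mult_2 mult_2_right)
    then show ?thesis
      using norm_mult_ineq[of "1 - 2 * q" "1 - 2 * p"] assms(1-4)
      by (simp add: norm_reflection_hermitian_idempotent)
  qed
  ultimately show ?thesis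
    using square_zero_eq_0_if_contraction[of "q - p"] by simp
qed

text \<open>
  For equal kernels, the order of the two reflections has to be reversed.
\<close>

lemma hermitian_idempotent_eq_if_same_kernel:
  fixes p q :: "'a::complex_banach_algebra_1"
  assumes "hermitian p" "hermitian q" and "p * p = p" "q * q = q"
    and "p * q = p" "q * p = q"
  shows "p = q"
proof -
  have "(q - p) * (q - p) = 0"
    using assms(3-6) by (simp add: algebra_simps)
  moreover have "norm (1 - 2 * (q - p)) \<le> 1"
  proof -
    have "(1 - 2 * p) * (1 - 2 * q) = 1 - 2 * (q - p)"
      using assms(3-6) by (simp add: algebra_simps mult_2 mult_2_right)
    then show ?thesis
      using norm_mult_ineq[of "1 - 2 * p" "1 - 2 * q"] assms(1-4)
      by (simp add: norm_reflection_hermitian_idempotent)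
  qed
  ultimately show ?thesis
    using square_zero_eq_0_if_contraction[of "q - p"] by simp
qed

section \<open>Moore-Penrose inverses and group inverses\<close>

lemma mp_inverse_idempotent:
  assumes "is_mp_inverse a x"
  shows "(a * x) * (a * x) = a * x" and "(x * a) * (x * a) = x * a"
  using assms unfolding is_mp_inverse_def by (metis mult.assoc)+

text \<open>
  Both \<open>a * x\<close> and \<open>a * y\<close> have the range of \<open>a\<close>, and both \<open>x * a\<close> and \<open>y * a\<close> its kernel.
\<close>

lemma mp_inverse_unique:
  assumes x: "is_mp_inverse a x" and y: "is_mp_inverse a y"
  shows "x = y"
proof -
  have ax: "a * x * a = a" and ay: "a * y * a = a"
    using x y unfolding is_mp_inverse_def by metis+
  have "a * x = a * y"
  proof (rule hermitian_idempotent_eq_if_same_range)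
    show "a * x * (a * y) = a * y" "a * y * (a * x) = a * x"
      using ax ay by (metis mult.assoc)+
  qed (use x y in \<open>simp_all add: mp_inverse_idempotent is_mp_inverse_def\<close>)
  moreover have "x * a = y * a"
  proof (rule hermitian_idempotent_eq_if_same_kernel)
    show "x * a * (y * a) = x * a" "y * a * (x * a) = y * a"
      using ax ay by (metis mult.assoc)+
  qed (use x y in \<open>simp_all add: mp_inverse_idempotent is_mp_inverse_def\<close>)
  ultimately show ?thesis
    using x y unfolding is_mp_inverse_def by (metis mult.assoc)
qed

lemma is_EP_iff_commute:
  assumes "is_mp_inverse a x"
  shows "is_EP a \<longleftrightarrow> a * x = x * a"
  using assms mp_inverse_unique unfolding is_EP_def by blast

lemma is_group_inverse_if_mp_commute:
  assumes "is_mp_inverse a x" and "a * x = x * a"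
  shows "is_group_inverse a x"
  using assms unfolding is_mp_inverse_def is_group_inverse_def by blast

text \<open>
  The idempotent \<open>a * b\<close> always has the range of \<open>a * x\<close>; the hypothesis makes it hermitian.
\<close>

lemma mp_commute_if_left_eq_group_idempotent:
  assumes x: "is_mp_inverse a x" and b: "is_group_inverse a b" and eq: "x * a = a * b"
  shows "a * x = x * a"
proof (rule hermitian_idempotent_eq_if_same_range)
  have axa: "a * x * a = a" and aba: "a * b * a = a"
    using x b unfolding is_mp_inverse_def is_group_inverse_def by metis+
  show "a * x * (x * a) = x * a"
    unfolding eq using axa by (metis mult.assoc)
  show "x * a * (a * x) = a * x"
    unfolding eq using aba by (metis mult.assoc)
qed (use x in \<open>simp_all add: mp_inverse_idempotent is_mp_inverse_def\<close>)

text \<open>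
  The idempotent \<open>b * a\<close> always has the kernel of \<open>x * a\<close>; the hypothesis makes it hermitian.
\<close>

lemma mp_commute_if_right_eq_group_idempotent:
  assumes x: "is_mp_inverse a x" and b: "is_group_inverse a b" and eq: "a * x = b * a"
  shows "a * x = x * a"
proof (rule hermitian_idempotent_eq_if_same_kernel)
  have axa: "a * x * a = a" and aba: "a * b * a = a"
    using x b unfolding is_mp_inverse_def is_group_inverse_def by metis+
  show "a * x * (x * a) = a * x"
    unfolding eq using axa by (metis mult.assoc)
  show "x * a * (a * x) = x * a"
    unfolding eq using aba by (metis mult.assoc)
qed (use x in \<open>simp_all add: mp_inverse_idempotent is_mp_inverse_def\<close>)

theorem theorem2p5:
  fixes a a_dag :: "'a::complex_banach_algebra_1"
  assumes "is_mp_inverse a a_dag"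
  shows "(is_EP a \<longleftrightarrow> (\<exists>b. is_group_inverse a b) \<and> a = a_dag * a^2)
       \<and> (is_EP a \<longleftrightarrow> (\<exists>b. is_group_inverse a b) \<and> a = a^2 * a_dag)
       \<and> (is_EP a \<longleftrightarrow> (\<exists>b. is_group_inverse a b) \<and> a_dag = a * a_dag^2)
       \<and> (is_EP a \<longleftrightarrow> (\<exists>b. is_group_inverse a b) \<and> a_dag = a_dag^2 * a)"
proof -
  let ?x = a_dag
  have axa: "a * ?x * a = a" and xax: "?x * a * ?x = ?x"
    using assms unfolding is_mp_inverse_def by metis+
  note EP = is_EP_iff_commute[OF assms]
  have group: "\<exists>b. is_group_inverse a b" if "is_EP a"
    using that EP is_group_inverse_if_mp_commute[OF assms] by blast
  have identities: "a = ?x * a^2" "a = a^2 * ?x" "?x = a * ?x^2" "?x = ?x^2 * a" if "is_EP a"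
    using that axa xax unfolding EP power2_eq_square by (metis mult.assoc)+
  have "is_EP a" if b: "is_group_inverse a b"
    and cases: "a = ?x * a^2 \<or> a = a^2 * ?x \<or> ?x = a * ?x^2 \<or> ?x = ?x^2 * a" for b
  proof -
    have aba: "a * b * a = a" and comm: "a * b = b * a"
      using b unfolding is_group_inverse_def by metis+
    have baa: "b * a * a = a" and aab: "a * a * b = a"
      using aba comm by (metis mult.assoc)+
    show ?thesis
      using cases
    proof (elim disjE)
      assume "a = ?x * a^2"
      then have "a * b = ?x * (a * a * b)"
        by (metis mult.assoc power2_eq_square)
      then have "?x * a = a * b"
        by (simp add: aab)
      then show ?thesis
        using mp_commute_if_left_eq_group_idempotent[OF assms b] EP by blast
    next
      assume "a = a^2 * ?x"
      then have "b * a = b * a * a * ?x"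
        by (metis mult.assoc power2_eq_square)
      then have "a * ?x = b * a"
        by (simp add: baa)
      then show ?thesis
        using mp_commute_if_right_eq_group_idempotent[OF assms b] EP by blast
    next
      assume "?x = a * ?x^2"
      \<comment> \<open>The range of \<open>?x\<close> lies in that of \<open>a\<close>, which \<open>b * a\<close> fixes.\<close>
      then have "b * a * ?x = ?x"
        by (metis baa mult.assoc)
      then have "?x * a = b * a * ?x * a"
        by simp
      also have "\<dots> = a * b"
        by (metis axa comm mult.assoc)
      finally show ?thesis
        using mp_commute_if_left_eq_group_idempotent[OF assms b] EP by blast
    next
      assume "?x = ?x^2 * a"
      \<comment> \<open>The kernel of \<open>?x\<close> contains that of \<open>a\<close>, into which \<open>1 - a * b\<close> maps.\<close>
      then have "?x * (a * b) = ?x"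
        by (metis aba comm mult.assoc)
      then have "a * ?x = a * ?x * a * b"
        by (simp add: mult.assoc)
      also have "\<dots> = b * a"
        by (simp add: axa comm)
      finally show ?thesis
        using mp_commute_if_right_eq_group_idempotent[OF assms b] EP by blast
    qed
  qed
  then show ?thesis
    using group identities by blast
qed

end
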